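(* There exists a countable ultrametric space $(X,d)$ with partially ordered value set such that its ultrametric ball space $(X,\mathcal{B}_d)$ is spherically complete, but there is no family $\mathcal{B}'\supseteq\mathcal{B}_d$ of nonempty subsets of $X$ such that $(X,\mathcal{B}')$ is both chain intersection closed and spherically complete.
   Context: A ball space $(X,\mathcal{B})$ is a nonempty set $X$ with a nonempty collection $\mathcal{B}$ of nonempty subsets of $X$. A chain in $\mathcal{B}$ is a nonempty subset linearly ordered by inclusion. $(X,\mathcal{B})$ is spherically complete if every chain has nonempty intersection, and chain intersection closed if the intersection of every chain in $\mathcal{B}$ is either empty or belongs to $\mathcal{B}$. An ultrametric on $X$ is a map $d:X\times X\to\Gamma$, $\Gamma$ a poset with least element $\bot$, such that for all $x,y,z\in X$, $\gamma\in\Gamma$: $d(x,y)=\bot$ iff $x=y$; if $d(x,y)\le\gamma$ and $d(y,z)\le\gamma$ then $d(x,z)\le\gamma$; $d(x,y)=d(y,x)$. $B(x,y)=\{z\in X:d(x,z)\le d(x,y)\}$ and $\mathcal{B}_d=\{B(x,y):x,y\in X\}$. *)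

theory Defs
  imports Main "HOL-Library.Countable_Set"
begin

definition ball_space :: "'a set \<Rightarrow> 'a set set \<Rightarrow> bool" where
  "ball_space X \<B> \<longleftrightarrow> X \<noteq> {} \<and> \<B> \<noteq> {} \<and> (\<forall>B\<in>\<B>. B \<noteq> {} \<and> B \<subseteq> X)"

definition chain_in :: "'a set set \<Rightarrow> 'a set set \<Rightarrow> bool" where
  "chain_in \<B> \<C> \<longleftrightarrow> \<C> \<noteq> {} \<and> subset.chain \<B> \<C>"

definition spherically_complete :: "'a set set \<Rightarrow> bool" where
  "spherically_complete \<B> \<longleftrightarrow> (\<forall>\<C>. chain_in \<B> \<C> \<longrightarrow> \<Inter>\<C> \<noteq> {})"

definition chain_intersection_closed :: "'a set set \<Rightarrow> bool" where
  "chain_intersection_closed \<B> \<longleftrightarrow> (\<forall>\<C>. chain_in \<B> \<C> \<longrightarrow> \<Inter>\<C> = {} \<or> \<Inter>\<C> \<in> \<B>)"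

text \<open>The value poset is given by a carrier \<open>\<Gamma>\<close> and its order relation \<open>r\<close>, where
  \<open>(\<alpha>, \<beta>) \<in> r\<close> means \<open>\<alpha> \<le> \<beta>\<close>.\<close>

definition poset_with_bot :: "'g set \<Rightarrow> 'g rel \<Rightarrow> 'g \<Rightarrow> bool" where
  "poset_with_bot \<Gamma> r b \<longleftrightarrow> partial_order_on \<Gamma> r \<and> b \<in> \<Gamma> \<and> (\<forall>\<gamma>\<in>\<Gamma>. (b, \<gamma>) \<in> r)"

definition ultrametric_on ::
  "'a set \<Rightarrow> 'g set \<Rightarrow> 'g rel \<Rightarrow> 'g \<Rightarrow> ('a \<Rightarrow> 'a \<Rightarrow> 'g) \<Rightarrow> bool" where
  "ultrametric_on X \<Gamma> r b d \<longleftrightarrow>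
     poset_with_bot \<Gamma> r b \<and>
     (\<forall>x\<in>X. \<forall>y\<in>X. d x y \<in> \<Gamma>) \<and>
     (\<forall>x\<in>X. \<forall>y\<in>X. d x y = b \<longleftrightarrow> x = y) \<and>
     (\<forall>x\<in>X. \<forall>y\<in>X. \<forall>z\<in>X. \<forall>\<gamma>\<in>\<Gamma>. (d x y, \<gamma>) \<in> r \<longrightarrow> (d y z, \<gamma>) \<in> r \<longrightarrow> (d x z, \<gamma>) \<in> r) \<and>
     (\<forall>x\<in>X. \<forall>y\<in>X. d x y = d y x)"

definition um_ball :: "'a set \<Rightarrow> 'g rel \<Rightarrow> ('a \<Rightarrow> 'a \<Rightarrow> 'g) \<Rightarrow> 'a \<Rightarrow> 'a \<Rightarrow> 'a set" where
  "um_ball X r d x y = {z \<in> X. (d x z, d x y) \<in> r}"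

definition um_balls :: "'a set \<Rightarrow> 'g rel \<Rightarrow> ('a \<Rightarrow> 'a \<Rightarrow> 'g) \<Rightarrow> 'a set set" where
  "um_balls X r d = {um_ball X r d x y | x y. x \<in> X \<and> y \<in> X}"

end

theory Submission
  imports Defs "HOL-Library.Nat_Bijection"
begin

text \<open>
  The points are \<open>c\<^sub>k\<close> and \<open>p\<^sub>n\<^sub>,\<^sub>m\<close>. Besides singletons and the whole space, the balls are the pairs
  \<open>{c\<^sub>i, c\<^sub>j}\<close> and the sets \<open>T\<^sub>n\<^sub>,\<^sub>m = {c\<^sub>k | k \<ge> n} \<union> {p\<^sub>n\<^sub>,\<^sub>k | k \<ge> m}\<close>. Any two points lie in a smallest
  ball, which can serve as their distance. Balls \<open>T\<^sub>n\<^sub>,\<^sub>m\<close> with different \<open>n\<close> are incomparable, so a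
  chain of infinite balls contains a tail \<open>{c\<^sub>k | k \<ge> n}\<close> in its intersection, while a chain with a finite
  member has a least element. But the tails are themselves intersections of chains of balls, and
  they form a chain with empty intersection.
\<close>

section \<open>Ultrametrics from smallest balls\<close>

text \<open>The value set consists of codes of the sets \<open>S x y\<close> with \<open>x \<noteq> y\<close>, ordered by inclusion; the
  code of the empty set is the least element, replacing all the singletons \<open>S x x\<close>.\<close>

lemma ultrametric_of_pair_hulls:
  fixes S :: "nat \<Rightarrow> nat \<Rightarrow> nat set"
  assumes diag: "\<And>x. S x x = {x}"
    and mem: "\<And>x y. x \<in> S x y" "\<And>x y. y \<in> S x y"
    and least: "\<And>x y u v. u \<in> S x y \<Longrightarrow> v \<in> S x y \<Longrightarrow> S u v \<subseteq> S x y"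
  obtains \<Gamma> :: "nat set" and r :: "nat rel" and b :: nat and d :: "nat \<Rightarrow> nat \<Rightarrow> nat"
  where "ultrametric_on UNIV \<Gamma> r b d" and "um_balls UNIV r d = {S x y | x y. True}"
proof -
  define G where "G x y = (if x = y then {} else S x y)" for x y
  define R where "R = {G x y | x y. True}"
  \<comment> \<open>Countability lets the values be coded by natural numbers.\<close>
  have "R = (\<lambda>(x, y). G x y) ` UNIV" by (auto simp: R_def)
  then have "countable R" by simp
  then have inj: "inj_on (to_nat_on R) R" by (rule inj_on_to_nat_on)
  define e where "e = to_nat_on R"
  define r where "r = {(e A, e B) | A B. A \<in> R \<and> B \<in> R \<and> A \<subseteq> B}"
  define d where "d x y = e (G x y)" for x y
  have e_eq: "e A = e B \<longleftrightarrow> A = B" if "A \<in> R" "B \<in> R" for A B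
    using inj that by (auto simp: e_def inj_on_def)
  have r_iff: "(e A, e B) \<in> r \<longleftrightarrow> A \<subseteq> B" if "A \<in> R" "B \<in> R" for A B
    using e_eq that by (auto simp: r_def)
  have G_R: "G x y \<in> R" for x y by (auto simp: R_def)
  have "G 0 0 = {}" by (simp add: G_def)
  then have empty_R: "{} \<in> R" using G_R by metis
  have G_empty: "G x y = {} \<longleftrightarrow> x = y" for x y
    using mem(1)[of x y] by (auto simp: G_def)
  have sym: "S x y = S y x" for x y
    using least mem by (metis subset_antisym)
  \<comment> \<open>The ultrametric inequality. For distinct points, \<open>A\<close> contains
    \<open>x\<close> and \<open>z\<close>; being some \<open>S u v\<close>, it then contains all of
    \<open>S x z\<close>.\<close>
  have G_trans: "G x z \<subseteq> A" if "A \<in> R" "G x y \<subseteq> A" "G y z \<subseteq> A" for A x y z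
  proof (cases "x = y \<or> y = z \<or> x = z")
    case True
    then show ?thesis using that by (auto simp: G_def)
  next
    case False
    then have xz: "x \<in> A" "z \<in> A" using that mem by (auto simp: G_def)
    obtain u v where "A = G u v" using \<open>A \<in> R\<close> by (auto simp: R_def)
    with xz have "A = S u v" by (auto simp: G_def split: if_splits)
    with xz least False show ?thesis by (simp add: G_def)
  qed
  have po: "partial_order_on (e ` R) r"
    unfolding partial_order_on_def preorder_on_def
  proof (intro conjI)
    show "r \<subseteq> e ` R \<times> e ` R" by (auto simp: r_def)
    show "refl_on (e ` R) r" using r_iff by (auto simp: refl_on_def)
    show "trans r"
    proof (rule transI)
      fix x y z assume "(x, y) \<in> r" "(y, z) \<in> r"
      then obtain A B B' C where "x = e A" "y = e B" "y = e B'" "z = e C"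
        "A \<in> R" "B \<in> R" "B' \<in> R" "C \<in> R" "A \<subseteq> B" "B' \<subseteq> C"
        by (auto simp: r_def)
      then show "(x, z) \<in> r" using e_eq r_iff by (metis subset_trans)
    qed
    show "antisym r"
    proof (rule antisymI)
      fix x y assume "(x, y) \<in> r" "(y, x) \<in> r"
      then obtain A B where "x = e A" "y = e B" "A \<in> R" "B \<in> R"
        by (auto simp: r_def)
      with \<open>(x, y) \<in> r\<close> \<open>(y, x) \<in> r\<close> show "x = y" by (simp add: r_iff)
    qed
  qed
  have "ultrametric_on UNIV (e ` R) r (e {}) d"
    unfolding ultrametric_on_def poset_with_bot_def
  proof (intro conjI ballI impI)
    fix x y z \<gamma>
    assume "\<gamma> \<in> e ` R" "(d x y, \<gamma>) \<in> r" "(d y z, \<gamma>) \<in> r"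
    then show "(d x z, \<gamma>) \<in> r"
      using G_trans by (auto simp: d_def r_iff G_R)
  next
    fix x y
    show "d x y = d y x" using sym[of x y] by (simp add: d_def G_def)
  qed (use po empty_R in \<open>auto simp: d_def G_R e_eq G_empty r_iff\<close>)
  moreover have "um_ball UNIV r d x y = S x y" for x y
  proof -
    \<comment> \<open>Passing from \<open>S x x\<close> to the empty set does not change the balls:
      radius zero still gives \<open>{x}\<close>, which is \<open>S x x\<close>.\<close>
    have "G x z \<subseteq> G x y \<longleftrightarrow> z \<in> S x y" for z
    proof
      assume sub: "G x z \<subseteq> G x y"
      show "z \<in> S x y"
      proof (cases "x = z")
        case True
        with mem show ?thesis by simp
      next
        case False
        with sub mem(2)[of z x] have "z \<in> G x y" by (auto simp: G_def)
        then show ?thesis by (simp add: G_def split: if_splits)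
      qed
    next
      assume "z \<in> S x y"
      with mem(1) have "S x z \<subseteq> S x y" by (rule least)
      with \<open>z \<in> S x y\<close> show "G x z \<subseteq> G x y" by (auto simp: G_def diag)
    qed
    then show ?thesis by (simp add: um_ball_def d_def r_iff G_R)
  qed
  then have "um_balls UNIV r d = {S x y | x y. True}"
    by (simp add: um_balls_def)
  ultimately show thesis by (rule that)
qed

section \<open>Chains with a finite member\<close>

text \<open>A finite member of least cardinality lies in every other member, since otherwise that
  member would be a proper subset of it, finite and smaller.\<close>

lemma chain_with_finite_member_Inter_nonempty:
  assumes chain: "subset.chain \<A> \<C>" and A: "A \<in> \<C>" "finite A" and "{} \<notin> \<C>"
  shows "\<Inter>\<C> \<noteq> {}"
proof -
  obtain M where M: "M \<in> \<C> \<and> finite M"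
    and min: "\<And>B. B \<in> \<C> \<and> finite B \<Longrightarrow> card M \<le> card B"
    using ex_has_least_nat[of "\<lambda>B. B \<in> \<C> \<and> finite B" A card] A by blast
  have "M \<subseteq> B" if "B \<in> \<C>" for B
  proof (rule ccontr)
    assume "\<not> M \<subseteq> B"
    then have "B \<subset> M" using chain M that by (auto simp: subset_chain_def)
    then have "finite B" "card B < card M"
      using M by (auto intro: finite_subset psubset_card_mono)
    with min that show False by fastforce
  qed
  then have "M \<subseteq> \<Inter>\<C>" by blast
  with M \<open>{} \<notin> \<C>\<close> show ?thesis by auto
qed

section \<open>The points and balls of the example\<close>

text \<open>Points are natural numbers read as pairs: \<open>(0, k)\<close> encodes \<open>c\<^sub>k\<close>, and \<open>(n, m)\<close> with \<open>n > 0\<close>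
  encodes \<open>p\<^sub>n\<^sub>,\<^sub>m\<close>.\<close>

definition row :: "nat \<Rightarrow> nat" where "row x = fst (prod_decode x)"

definition col :: "nat \<Rightarrow> nat" where "col x = snd (prod_decode x)"

lemma row_prod_encode [simp]: "row (prod_encode (n, m)) = n"
  and col_prod_encode [simp]: "col (prod_encode (n, m)) = m"
  by (simp_all add: row_def col_def)

text \<open>The set \<open>T\<^sub>n\<^sub>,\<^sub>m\<close>, a ball for positive \<open>n\<close>.
  As \<open>n\<close> is both a row and the start of a tail, distinct rows meet and the tails shrink
  as \<open>n\<close> grows.\<close>

definition tail_ball :: "nat \<Rightarrow> nat \<Rightarrow> nat set" where
  "tail_ball n m = {z. row z = 0 \<and> n \<le> col z \<or> row z = n \<and> m \<le> col z}"

definition tail :: "nat \<Rightarrow> nat set" where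
  "tail n = {z. row z = 0 \<and> n \<le> col z}"

text \<open>The smallest ball containing both points. It is \<open>UNIV\<close> for two different
  positive rows, and for \<open>c\<^sub>k\<close> with \<open>p\<^sub>n\<^sub>,\<^sub>m\<close> when
  k < n.\<close>

definition hull :: "nat \<Rightarrow> nat \<Rightarrow> nat set" where
  "hull x y =
    (if x = y then {x}
     else if row x = 0 \<and> row y = 0 then {x, y}
     else if row x = row y then tail_ball (row x) (min (col x) (col y))
     else if row x = 0 \<and> row y \<le> col x then tail_ball (row y) (col y)
     else if row y = 0 \<and> row x \<le> col y then tail_ball (row x) (col x)
     else UNIV)"

lemma hull_self: "hull x x = {x}"
  by (simp add: hull_def)

lemma hull_mem: "x \<in> hull x y" "y \<in> hull x y"
  by (auto simp: hull_def tail_ball_def)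

lemma hull_cases:
  obtains "hull x y = {x, y}" "x = y \<or> row x = 0 \<and> row y = 0"
  | n m where "0 < n" "hull x y = tail_ball n m"
  | "hull x y = UNIV"
proof -
  have "hull x y = {x, y} \<and> (x = y \<or> row x = 0 \<and> row y = 0) \<or>
      (\<exists>n>0. \<exists>m. hull x y = tail_ball n m) \<or> hull x y = UNIV"
    unfolding hull_def by (cases "row x = 0"; cases "row y = 0") auto
  then show thesis using that by blast
qed

text \<open>Two points of row 0 span only a pair; if one of the points is in row \<open>n\<close>,
  the hull is a tail ball of that row starting at column \<open>m\<close> or later.\<close>

lemma hull_subset_tail_ball:
  assumes "0 < n" "u \<in> tail_ball n m" "v \<in> tail_ball n m"
  shows "hull u v \<subseteq> tail_ball n m"
proof (cases "u = v")
  case True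
  with assms show ?thesis by (simp add: hull_self)
next
  case False
  have mono: "tail_ball n k \<subseteq> tail_ball n m" if "m \<le> k" for k
    using that by (auto simp: tail_ball_def)
  have u: "row u = 0 \<and> n \<le> col u \<or> row u = n \<and> m \<le> col u"
    and v: "row v = 0 \<and> n \<le> col v \<or> row v = n \<and> m \<le> col v"
    using assms by (simp_all add: tail_ball_def)
  from u v show ?thesis
  proof (elim disjE)
    assume "row u = 0 \<and> n \<le> col u" "row v = 0 \<and> n \<le> col v"
    then show ?thesis using False assms(2,3) by (simp add: hull_def)
  qed (use False \<open>0 < n\<close> mono in \<open>simp_all add: hull_def\<close>)
qed

lemma hull_least:
  assumes "u \<in> hull x y" "v \<in> hull x y"
  shows "hull u v \<subseteq> hull x y"
proof (cases x y rule: hull_cases)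
  case 1
  with assms have "u \<in> {x, y}" "v \<in> {x, y}" by simp_all
  moreover from this 1(2) have "hull u v = {u, v}" by (auto simp: hull_def)
  ultimately show ?thesis unfolding 1(1) by simp
next
  case (2 n m)
  with assms show ?thesis using hull_subset_tail_ball by simp
next
  case 3
  then show ?thesis by simp
qed

text \<open>Two neighbours in row \<open>n\<close> are taken because a single point spans only a
  singleton.\<close>

lemma tail_ball_eq_hull:
  assumes "0 < n"
  shows "tail_ball n m = hull (prod_encode (n, m)) (prod_encode (n, Suc m))"
  using assms by (simp add: hull_def)

text \<open>The point \<open>p\<^sub>n\<^sub>,\<^sub>m\<close> of a positive row lies in tail balls
  of that row only.\<close>

lemma tail_ball_subset_imp_eq:
  assumes "tail_ball n m \<subseteq> tail_ball n' m'" "0 < n"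
  shows "n = n'"
proof -
  have "prod_encode (n, m) \<in> tail_ball n m" by (simp add: tail_ball_def)
  with assms have "prod_encode (n, m) \<in> tail_ball n' m'" by blast
  with \<open>0 < n\<close> show ?thesis by (simp add: tail_ball_def)
qed

section \<open>Spherical completeness\<close>

lemma spherically_complete_hulls: "spherically_complete {hull x y | x y. True}"
  unfolding spherically_complete_def chain_in_def
proof (intro allI impI, elim conjE)
  fix \<C> :: "nat set set"
  assume "\<C> \<noteq> {}" and chain: "subset.chain {hull x y | x y. True} \<C>"
  have sub: "\<exists>x y. B = hull x y" if "B \<in> \<C>" for B
    using chain that by (auto simp: subset_chain_def)
  have comparable: "A \<subseteq> B \<or> B \<subseteq> A" if "A \<in> \<C>" "B \<in> \<C>" for A B
    using chain that by (auto simp: subset_chain_def)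
  have nonempty: "{} \<notin> \<C>" using sub hull_mem by blast
  show "\<Inter>\<C> \<noteq> {}"
  proof (cases "\<exists>A\<in>\<C>. finite A")
    case True
    then obtain A where "A \<in> \<C>" "finite A" by blast
    then show ?thesis
      by (rule chain_with_finite_member_Inter_nonempty[OF chain _ _ nonempty])
  next
    case False
    have cases: "B = UNIV \<or> (\<exists>n m. 0 < n \<and> B = tail_ball n m)" if B: "B \<in> \<C>" for B
    proof -
      obtain x y where xy: "B = hull x y" using sub B by blast
      have "infinite B" using False B by blast
      with xy show ?thesis by (cases x y rule: hull_cases) auto
    qed
    show ?thesis
    proof (cases "\<exists>n m. 0 < n \<and> tail_ball n m \<in> \<C>")
      case True
      then obtain n m where nm: "0 < n" "tail_ball n m \<in> \<C>" by blast
      \<comment> \<open>The point \<open>c\<^sub>n\<close> starts the tail shared by all tail balls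
        of row \<open>n\<close>.\<close>
      have "prod_encode (0, n) \<in> B" if B: "B \<in> \<C>" for B
        using cases[OF B]
      proof (elim disjE exE conjE)
        fix n' m' assume n': "0 < n'" "B = tail_ball n' m'"
        have "n = n'"
          using comparable[OF nm(2) B] nm(1) n' tail_ball_subset_imp_eq by metis
        then show ?thesis using n' by (simp add: tail_ball_def)
      qed simp
      then show ?thesis by blast
    next
      case False
      with cases have "B = UNIV" if "B \<in> \<C>" for B using that by blast
      then show ?thesis by blast
    qed
  qed
qed

section \<open>Obstruction to an extension\<close>

lemma Inter_tail_balls:
  assumes "0 < n"
  shows "(\<Inter>m. tail_ball n m) = tail n"
proof
  show "(\<Inter>m. tail_ball n m) \<subseteq> tail n"
  proof
    fix z assume "z \<in> (\<Inter>m. tail_ball n m)"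
    \<comment> \<open>A start beyond the column of \<open>z\<close> rules out that \<open>z\<close>
      enters through row \<open>n\<close>.\<close>
    then have "z \<in> tail_ball n (Suc (col z))" by blast
    then show "z \<in> tail n" by (simp add: tail_ball_def tail_def)
  qed
qed (auto simp: tail_ball_def tail_def)

lemma decseq_chain_in:
  fixes F :: "nat \<Rightarrow> 'a set"
  assumes "\<And>n. F n \<in> \<B>" "antimono F"
  shows "chain_in \<B> (range F)"
proof -
  have "F i \<subseteq> F j \<or> F j \<subseteq> F i" for i j
    using nat_le_linear[of i j] antimonoD[OF assms(2)] by blast
  then show ?thesis using assms(1) by (auto simp: chain_in_def subset_chain_def)
qed

lemma no_closed_complete_extension_of_hulls:
  assumes sub: "{hull x y | x y. True} \<subseteq> \<B>"
    and closed: "chain_intersection_closed \<B>"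
    and complete: "spherically_complete \<B>"
  shows False
proof -
  \<comment> \<open>\<open>Suc\<close> keeps the row positive, so that the tail balls used are
    hulls.\<close>
  have "tail (Suc n) \<in> \<B>" for n
  proof -
    have "tail_ball (Suc n) m \<in> \<B>" for m
      using sub tail_ball_eq_hull[of "Suc n" m] by auto
    moreover have "antimono (tail_ball (Suc n))"
      by (auto simp: antimono_def tail_ball_def)
    ultimately have "chain_in \<B> (range (tail_ball (Suc n)))"
      by (rule decseq_chain_in)
    then have "tail (Suc n) = {} \<or> tail (Suc n) \<in> \<B>"
      using closed Inter_tail_balls[of "Suc n"]
      by (metis chain_intersection_closed_def zero_less_Suc)
    moreover have "prod_encode (0, Suc n) \<in> tail (Suc n)"
      by (simp add: tail_def)
    ultimately show ?thesis by blast
  qed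
  moreover have "antimono (\<lambda>n. tail (Suc n))"
    by (auto simp: antimono_def tail_def)
  ultimately have "chain_in \<B> (range (\<lambda>n. tail (Suc n)))"
    by (rule decseq_chain_in)
  then have "(\<Inter>n. tail (Suc n)) \<noteq> {}"
    using complete unfolding spherically_complete_def by blast
  then obtain z where "\<And>n. z \<in> tail (Suc n)" by blast
  \<comment> \<open>No point lies in a tail that starts just past its own column.\<close>
  then have "z \<in> tail (Suc (col z))" .
  then show False by (simp add: tail_def)
qed

theorem theorem1p3:
  "\<exists>(X :: nat set) (\<Gamma> :: nat set) (r :: nat rel) (b :: nat) (d :: nat \<Rightarrow> nat \<Rightarrow> nat).
     X \<noteq> {} \<and> countable X \<and> ultrametric_on X \<Gamma> r b d \<and>
     ball_space X (um_balls X r d) \<and>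
     spherically_complete (um_balls X r d) \<and>
     \<not> (\<exists>\<B>'. um_balls X r d \<subseteq> \<B>' \<and> ball_space X \<B>' \<and>
            chain_intersection_closed \<B>' \<and> spherically_complete \<B>')"
proof -
  obtain \<Gamma> :: "nat set" and r :: "nat rel" and b :: nat and d :: "nat \<Rightarrow> nat \<Rightarrow> nat"
    where um: "ultrametric_on UNIV \<Gamma> r b d"
      and balls: "um_balls UNIV r d = {hull x y | x y. True}"
    by (rule ultrametric_of_pair_hulls[OF hull_self hull_mem hull_least])
  have "ball_space UNIV (um_balls UNIV r d)"
    unfolding balls ball_space_def using hull_mem by blast
  moreover have "\<not> (\<exists>\<B>'. um_balls UNIV r d \<subseteq> \<B>' \<and> ball_space UNIV \<B>' \<and>
      chain_intersection_closed \<B>' \<and> spherically_complete \<B>')"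
    unfolding balls using no_closed_complete_extension_of_hulls by blast
  ultimately show ?thesis
    using um spherically_complete_hulls balls
    by (intro exI[of _ UNIV] exI[of _ \<Gamma>] exI[of _ r] exI[of _ b] exI[of _ d]) simp
qed

end
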